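(* Let $\langle(p^{(t)},\Omega_t)\mid t\in\mathbb{N}^0\rangle$ be a linear dynamic optimization (LDO) problem on $X=[0,b]$, $b>0$, with optimal period-$T$ decision rules $h^T$, $T\in\mathbb{N}^0$. (i) For all $T\in\mathbb{N}^0$, the optimal period-$T$ decision rule $h^T$ is upper semi-continuous (at every $x\in X$). (ii) For all $T\in\mathbb{N}^0$ and $(x,y)\in\Omega_T$: if $y\notin h^T(x)$ then $V^T(x)>p^{(T)}x+V^{T+1}(y)$. (iii) For $x\in X$ and a sequence $\langle x_t\mid t\in\mathbb{N}^0\rangle$ in $X$: $\langle x_t\mid t\in\mathbb{N}^0\rangle\in\mathcal{S}(x)$ if and only if $x_0=x$ and $x_{T+1}\in h^T(x_T)$ for all $T\in\mathbb{N}^0$.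
   Context: $\mathbb{N}^0=\{0,1,2,\dots\}$. An LDO problem $\langle(p^{(t)},\Omega_t)\mid t\in\mathbb{N}^0\rangle$ on $X=[0,b]$ consists of a sequence of real numbers $p^{(t)}$ with $\sum_{t=0}^\infty|p^{(t)}|<+\infty$ and sets $\Omega_t\subset X\times X$ such that for every $t\in\mathbb{N}^0$: (i) $\Omega_t$ is non-empty, closed and convex; (ii) for every $x\in X$ there is $y\in X$ with $(x,y)\in\Omega_t$. Write $\Omega_t(x)=\{y\mid(x,y)\in\Omega_t\}$. For $T\in\mathbb{N}^0$ and $y\in X$, $\mathcal{F}^T(y)$ is the set of sequences $\langle x_t\mid t\ge T\rangle$ in $X$ with $x_T=y$ and $(x_t,x_{t+1})\in\Omega_t$ for all $t\ge T$; $\mathcal{S}^T(y)$ is the set of maximizers of $\sum_{t=T}^\infty p^{(t)}x_t$ over $\langle x_t\mid t\ge T\rangle\in\mathcal{F}^T(y)$. The set $\mathcal{S}^T(y)$ is non-empty for every $y\in X$, and $V^T:X\to\mathbb{R}$ is defined by $V^T(y)=\sum_{t=T}^\infty p^{(t)}x_t$ for any $\langle x_t\mid t\ge T\rangle\in\mathcal{S}^T(y)$. Write $\mathcal{S}=\mathcal{S}^0$. The optimal period-$T$ decision rule is the correspondence (set-valued map) $h^T$ from $X$ to $X$ given by $h^T(x)=\operatorname{argmax}_{y\in\Omega_T(x)}V^{T+1}(y)$. It is called upper semi-continuous at $x\in X$ if for all $y\in X$ and all sequences $\langle x^{(n)}\mid n\in\mathbb{N}\rangle$, $\langle y^{(n)}\mid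 n\in\mathbb{N}\rangle$ in $X$ converging to $x$ and $y$ respectively: $y^{(n)}\in h^T(x^{(n)})$ for all $n$ implies $y\in h^T(x)$. *)

theory Defs
  imports "HOL-Analysis.Analysis"
begin

definition ldo_problem :: "real \<Rightarrow> (nat \<Rightarrow> real) \<Rightarrow> (nat \<Rightarrow> (real \<times> real) set) \<Rightarrow> bool" where
  "ldo_problem b p \<Omega> \<longleftrightarrow>
     summable (\<lambda>t. \<bar>p t\<bar>) \<and>
     (\<forall>t. \<Omega> t \<subseteq> {0..b} \<times> {0..b} \<and>
          \<Omega> t \<noteq> {} \<and> closed (\<Omega> t) \<and> convex (\<Omega> t) \<and>
          (\<forall>x\<in>{0..b}. \<exists>y\<in>{0..b}. (x, y) \<in> \<Omega> t))"

text \<open>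
  A sequence indexed by the times \<open>t \<ge> T\<close> is an extensional function on \<open>{T..}\<close>, so the
  default value at times before \<open>T\<close> carries no information. For \<open>T = 0\<close> these are all
  functions from \<open>nat\<close> into \<open>{0..b}\<close>.
\<close>

definition feasible ::
  "real \<Rightarrow> (nat \<Rightarrow> (real \<times> real) set) \<Rightarrow> nat \<Rightarrow> real \<Rightarrow> (nat \<Rightarrow> real) set" where
  "feasible b \<Omega> T y =
     {x \<in> {T..} \<rightarrow>\<^sub>E {0..b}. x T = y \<and> (\<forall>t\<ge>T. (x t, x (Suc t)) \<in> \<Omega> t)}"

text \<open>The sum over all \<open>t \<ge> T\<close>, reindexed by \<open>t = T + n\<close>.\<close>

definition payoff :: "(nat \<Rightarrow> real) \<Rightarrow> nat \<Rightarrow> (nat \<Rightarrow> real) \<Rightarrow> real" where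
  "payoff p T x = (\<Sum>n. p (T + n) * x (T + n))"

definition solutions ::
  "real \<Rightarrow> (nat \<Rightarrow> real) \<Rightarrow> (nat \<Rightarrow> (real \<times> real) set) \<Rightarrow> nat \<Rightarrow> real \<Rightarrow> (nat \<Rightarrow> real) set" where
  "solutions b p \<Omega> T y = {x. is_arg_max (payoff p T) (\<lambda>x. x \<in> feasible b \<Omega> T y) x}"

definition val ::
  "real \<Rightarrow> (nat \<Rightarrow> real) \<Rightarrow> (nat \<Rightarrow> (real \<times> real) set) \<Rightarrow> nat \<Rightarrow> real \<Rightarrow> real" where
  "val b p \<Omega> T y = payoff p T (SOME x. x \<in> solutions b p \<Omega> T y)"

text \<open>The value does not depend on the chosen maximizer.\<close>

lemma val_eq_payoff:
  assumes "x \<in> solutions b p \<Omega> T y"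
  shows "val b p \<Omega> T y = payoff p T x"
proof -
  have "(SOME x. x \<in> solutions b p \<Omega> T y) \<in> solutions b p \<Omega> T y"
    using assms by (rule someI[where P = "\<lambda>x. x \<in> solutions b p \<Omega> T y"])
  with assms show ?thesis
    unfolding val_def solutions_def is_arg_max_linorder by (simp add: order_antisym)
qed

definition decision_rule ::
  "real \<Rightarrow> (nat \<Rightarrow> real) \<Rightarrow> (nat \<Rightarrow> (real \<times> real) set) \<Rightarrow> nat \<Rightarrow> real \<Rightarrow> real set" where
  "decision_rule b p \<Omega> T x =
     {y. is_arg_max (val b p \<Omega> (Suc T)) (\<lambda>y. (x, y) \<in> \<Omega> T) y}"

definition usc_at :: "real set \<Rightarrow> (real \<Rightarrow> real set) \<Rightarrow> real \<Rightarrow> bool" where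
  "usc_at X h x \<longleftrightarrow>
     (\<forall>y\<in>X. \<forall>xs ys. range xs \<subseteq> X \<longrightarrow> range ys \<subseteq> X \<longrightarrow>
        xs \<longlonglongrightarrow> x \<longrightarrow> ys \<longlonglongrightarrow> y \<longrightarrow> (\<forall>n::nat. ys n \<in> h (xs n)) \<longrightarrow> y \<in> h x)"

end

theory Submission
  imports Defs
begin

text \<open>
  The pairs (initial state, total payoff) attained by feasible sequences from time \<open>T\<close> form a
  compact convex subset of the plane, the value function being its upper boundary. Compactness
  makes the value upper semi-continuous. Convexity makes it lower semi-continuous, also at the end
  points of \<open>[0,b]\<close>, since a concave function on an interval lies above its chords. As the value
  satisfies the Bellman equation, \<open>h\<^sup>T(x)\<close> consists of the \<open>y\<close> with
  \<open>V\<^sup>T(x) = p\<^sup>T x + V\<^sup>T\<^sup>+\<^sup>1(y)\<close>, a closed condition on \<open>(x, y)\<close>. Iterating this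
  equation along a sequence, with a remainder dominated by a tail of \<open>\<Sum>\<bar>p\<bar>\<close>, gives (iii).
\<close>

lemma continuous_on_coordinate:
  "continuous_on S (\<lambda>x :: 'a \<Rightarrow> 'b :: topological_space. x i)"
  by (rule continuous_on_subset[OF continuous_on_product_coordinates]) simp

text \<open>Moving from \<open>(x, v)\<close> along segments towards the points of \<open>K\<close>
  over \<open>a\<close> and \<open>b\<close> traces a piecewise linear function \<open>w\<close>
  with \<open>w x = v\<close>; its values along \<open>xs\<close> serve as
  \<open>ws\<close>.\<close>

lemma convex_section_lower_semicontinuous:
  fixes K :: "(real \<times> real) set"
  assumes "convex K" "(a, v\<^sub>a) \<in> K" "(b, v\<^sub>b) \<in> K" "(x, v) \<in> K"
    and xs: "xs \<longlonglongrightarrow> x" "range xs \<subseteq> {a..b}"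
  obtains ws where "ws \<longlonglongrightarrow> v" "\<And>n::nat. (xs n, ws n) \<in> K"
proof -
  have seg: "(s, v + (s - x) * ((u - v) / (e - x))) \<in> K"
    if "(e, u) \<in> K" "x \<noteq> e" "0 \<le> (s - x) / (e - x)" "(s - x) / (e - x) \<le> 1" for e u s
  proof -
    define l where "l = (s - x) / (e - x)"
    have "(1 - l) *\<^sub>R (x, v) + l *\<^sub>R (e, u) \<in> K"
      using assms that unfolding l_def[symmetric] by (intro convexD) auto
    moreover have "s = x + l * (e - x)" "(s - x) * ((u - v) / (e - x)) = l * (u - v)"
      using that(2) by (simp_all add: l_def)
    then have "(1 - l) *\<^sub>R (x, v) + l *\<^sub>R (e, u) = (s, v + (s - x) * ((u - v) / (e - x)))"
      by (simp add: algebra_simps)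
    ultimately show ?thesis by simp
  qed
  \<comment> \<open>For \<open>s\<close> in \<open>{a..b}\<close> a zero denominator is harmless:
    \<open>s > x\<close> forces \<open>b > x\<close>, \<open>s < x\<close> forces
    \<open>a < x\<close>, and at \<open>s = x\<close> the factor \<open>s - x\<close>
    vanishes.\<close>
  define w where "w s = v + (if s > x then (s - x) * ((v\<^sub>b - v) / (b - x))
    else (s - x) * ((v\<^sub>a - v) / (a - x)))" for s
  have wK: "(s, w s) \<in> K" if "s \<in> {a..b}" for s
  proof (cases s x rule: linorder_cases)
    case less
    then show ?thesis
      using that seg[OF assms(2), of s] by (simp add: w_def divide_nonpos_nonpos divide_le_eq_1)
  next
    case equal
    then show ?thesis using assms by (simp add: w_def)
  next
    case greater
    then show ?thesis
      using that seg[OF assms(3), of s] by (simp add: w_def divide_le_eq_1)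
  qed
  define c where "c = \<bar>(v\<^sub>b - v) / (b - x)\<bar> + \<bar>(v\<^sub>a - v) / (a - x)\<bar>"
  have "\<bar>w s - v\<bar> \<le> \<bar>s - x\<bar> * c" for s
  proof -
    have "\<bar>(s - x) * k\<bar> \<le> \<bar>s - x\<bar> * (\<bar>k\<bar> + \<bar>k'\<bar>)"
      "\<bar>(s - x) * k\<bar> \<le> \<bar>s - x\<bar> * (\<bar>k'\<bar> + \<bar>k\<bar>)" for k k'
      by (simp_all add: abs_mult distrib_left)
    then show ?thesis
      unfolding w_def c_def by (simp only: add_diff_cancel_left' simp_thms split: if_split)
  qed
  then have "\<forall>\<^sub>F n in sequentially. norm (w (xs n) - v) \<le> \<bar>xs n - x\<bar> * c"
    by simp
  moreover have "(\<lambda>n. \<bar>xs n - x\<bar> * c) \<longlonglongrightarrow> 0"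
    by (rule tendsto_mult_left_zero[OF tendsto_rabs_zero[OF LIM_zero[OF xs(1)]]])
  ultimately have "(\<lambda>n. w (xs n) - v) \<longlonglongrightarrow> 0"
    by (rule Lim_null_comparison)
  then have "(\<lambda>n. w (xs n)) \<longlonglongrightarrow> v"
    by (rule LIM_zero_cancel)
  then show ?thesis
    using wK xs(2) by (intro that[of "\<lambda>n. w (xs n)"]) blast+
qed

section \<open>Paths, their totals and attained pairs\<close>

locale ldo =
  fixes b :: real and p :: "nat \<Rightarrow> real" and \<Omega> :: "nat \<Rightarrow> (real \<times> real) set"
  assumes b_pos: "b > 0" and ldo: "ldo_problem b p \<Omega>"
begin

text \<open>Feasible sequences from time \<open>T\<close>, reindexed to start at \<open>0\<close>.\<close>

definition paths :: "nat \<Rightarrow> (nat \<Rightarrow> real) set" where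
  "paths T = {z. (\<forall>n. z n \<in> {0..b}) \<and> (\<forall>n. (z n, z (Suc n)) \<in> \<Omega> (T + n))}"

definition total :: "nat \<Rightarrow> (nat \<Rightarrow> real) \<Rightarrow> real" where
  "total T z = (\<Sum>n. p (T + n) * z n)"

definition outcomes :: "nat \<Rightarrow> (real \<times> real) set" where
  "outcomes T = (\<lambda>z. (z 0, total T z)) ` paths T"

abbreviation V :: "nat \<Rightarrow> real \<Rightarrow> real" where
  "V \<equiv> val b p \<Omega>"

lemma Omega_bounds: "(x, y) \<in> \<Omega> T \<Longrightarrow> x \<in> {0..b} \<and> y \<in> {0..b}"
  using ldo unfolding ldo_problem_def by blast

lemma closed_Omega: "closed (\<Omega> T)"
  using ldo unfolding ldo_problem_def by blast

lemma convex_Omega: "convex (\<Omega> T)"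
  using ldo unfolding ldo_problem_def by blast

lemma Omega_successor: "x \<in> {0..b} \<Longrightarrow> \<exists>y. (x, y) \<in> \<Omega> T"
  using ldo unfolding ldo_problem_def by blast

lemma summable_abs_p: "summable (\<lambda>n. \<bar>p (T + n)\<bar>)"
  using ldo summable_ignore_initial_segment[of "\<lambda>n. \<bar>p n\<bar>" T]
  unfolding ldo_problem_def by (simp add: add.commute)

lemma pathsI: "(\<And>n. (z n, z (Suc n)) \<in> \<Omega> (T + n)) \<Longrightarrow> z \<in> paths T"
  unfolding paths_def using Omega_bounds by blast

lemma paths_bounds: "z \<in> paths T \<Longrightarrow> 0 \<le> z n \<and> z n \<le> b"
  unfolding paths_def by auto

lemma term_bound: "z \<in> paths T \<Longrightarrow> \<bar>p (T + n) * z n\<bar> \<le> \<bar>p (T + n)\<bar> * b"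
  using paths_bounds[of z T n] by (auto simp: abs_mult intro!: mult_left_mono)

lemma summable_abs_terms: "z \<in> paths T \<Longrightarrow> summable (\<lambda>n. \<bar>p (T + n) * z n\<bar>)"
  using term_bound
  by (intro summable_comparison_test[OF _ summable_mult2[OF summable_abs_p[of T], of b]]) auto

lemma summable_terms: "z \<in> paths T \<Longrightarrow> summable (\<lambda>n. p (T + n) * z n)"
  by (rule summable_rabs_cancel[OF summable_abs_terms])

lemma total_bound:
  assumes "z \<in> paths T"
  shows "\<bar>total T z\<bar> \<le> (\<Sum>n. \<bar>p (T + n)\<bar>) * b"
proof -
  have "\<bar>total T z\<bar> \<le> (\<Sum>n. \<bar>p (T + n) * z n\<bar>)"
    unfolding total_def by (rule summable_rabs[OF summable_abs_terms[OF assms]])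
  also have "\<dots> \<le> (\<Sum>n. \<bar>p (T + n)\<bar> * b)"
    by (intro suminf_le term_bound assms summable_abs_terms summable_mult2 summable_abs_p)
  also have "\<dots> = (\<Sum>n. \<bar>p (T + n)\<bar>) * b"
    by (rule suminf_mult2[symmetric, OF summable_abs_p])
  finally show ?thesis .
qed

lemma paths_tail: "z \<in> paths T \<Longrightarrow> (\<lambda>n. z (Suc n)) \<in> paths (Suc T)"
  unfolding paths_def by (auto simp: add_Suc_right[symmetric] simp del: add_Suc_right)

lemma total_split:
  assumes "z \<in> paths T"
  shows "total T z = p T * z 0 + total (Suc T) (\<lambda>n. z (Suc n))"
  using suminf_split_head[OF summable_terms[OF assms]] unfolding total_def by simp

lemma paths_cons:
  assumes "(x, z 0) \<in> \<Omega> T" "z \<in> paths (Suc T)"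
  shows "case_nat x z \<in> paths T"
proof (rule pathsI)
  show "(case_nat x z n, case_nat x z (Suc n)) \<in> \<Omega> (T + n)" for n
    using assms by (cases n) (auto simp: paths_def)
qed

text \<open>With \<open>outcomes_uncons\<close> this is the Bellman recursion for attained pairs,
  before any maximization: a path is a first edge followed by a path one period later.\<close>

lemma outcomes_cons:
  assumes "(x, y) \<in> \<Omega> T" "(y, v) \<in> outcomes (Suc T)"
  shows "(x, p T * x + v) \<in> outcomes T"
proof -
  obtain z where z: "z \<in> paths (Suc T)" "y = z 0" "v = total (Suc T) z"
    using assms(2) unfolding outcomes_def by auto
  then have "case_nat x z \<in> paths T" using assms(1) by (simp add: paths_cons)
  then show ?thesis
    using z unfolding outcomes_def by (intro image_eqI[of _ _ "case_nat x z"]) (auto simp: total_split)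
qed

lemma outcomes_uncons:
  assumes "(x, v) \<in> outcomes T"
  obtains y u where "(x, y) \<in> \<Omega> T" "(y, u) \<in> outcomes (Suc T)" "v = p T * x + u"
proof -
  obtain z where z: "z \<in> paths T" "x = z 0" "v = total T z"
    using assms unfolding outcomes_def by auto
  have "(z 0, z (Suc 0)) \<in> \<Omega> (T + 0)" using z(1) unfolding paths_def by blast
  moreover have "(z (Suc 0), total (Suc T) (\<lambda>n. z (Suc n))) \<in> outcomes (Suc T)"
    unfolding outcomes_def by (rule image_eqI[OF _ paths_tail[OF z(1)]]) simp
  ultimately show ?thesis
    using z total_split[OF z(1)] by (intro that) auto
qed

lemma outcomes_nonempty_section:
  assumes "x \<in> {0..b}"
  shows "\<exists>v. (x, v) \<in> outcomes T"
proof -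
  \<comment> \<open>The implication from \<open>n = 0\<close> fixes the initial state; membership in
    \<open>{0..b}\<close> is carried along so that a successor always exists.\<close>
  have "\<exists>z. \<forall>n. (z n \<in> {0..b} \<and> (n = 0 \<longrightarrow> z n = x)) \<and> (z n, z (Suc n)) \<in> \<Omega> (T + n)"
  proof (rule dependent_nat_choice)
    show "\<exists>z. z \<in> {0..b} \<and> (0 = 0 \<longrightarrow> z = x)" using assms by blast
    show "\<exists>y. (y \<in> {0..b} \<and> (Suc n = 0 \<longrightarrow> y = x)) \<and> (z, y) \<in> \<Omega> (T + n)"
      if "z \<in> {0..b} \<and> (n = 0 \<longrightarrow> z = x)" for z n
      using Omega_successor[of z "T + n"] Omega_bounds that by blast
  qed
  then obtain z where z: "\<And>n. (z n, z (Suc n)) \<in> \<Omega> (T + n)" "z 0 = x"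
    by blast
  then show ?thesis unfolding outcomes_def by (blast intro: pathsI)
qed

section \<open>Compactness and convexity of the attained pairs\<close>

text \<open>By Tychonoff the product of the intervals is compact, and each edge condition involves
  only two coordinates, hence is closed in the product topology.\<close>

lemma compact_paths: "compact (paths T)"
proof -
  have "compact (PiE UNIV (\<lambda>_::nat. {0..b}))"
    using compactin_PiE[of "\<lambda>_. euclidean" "UNIV :: nat set" "\<lambda>_. {0..b}"]
    by (simp add: euclidean_product_topology)
  moreover have "closed {z. \<forall>n. (z n, z (Suc n)) \<in> \<Omega> (T + n)}"
  proof (rule closed_Collect_all)
    fix n
    have "continuous_on UNIV (\<lambda>z :: nat \<Rightarrow> real. (z n, z (Suc n)))"
      by (intro continuous_on_Pair continuous_on_product_coordinates)
    from closed_vimage[OF closed_Omega this]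
    show "closed {z. (z n, z (Suc n)) \<in> \<Omega> (T + n)}" by (simp add: vimage_def)
  qed
  moreover have "paths T = PiE UNIV (\<lambda>_. {0..b}) \<inter> {z. \<forall>n. (z n, z (Suc n)) \<in> \<Omega> (T + n)}"
    unfolding paths_def by auto
  ultimately show ?thesis by (simp add: compact_Int_closed)
qed

text \<open>The partial sums depend on finitely many coordinates and converge uniformly, with the
  summable majorant \<open>\<bar>p (T + n)\<bar> * b\<close>.\<close>

lemma continuous_on_total: "continuous_on (paths T) (total T)"
proof (rule uniform_limit_theorem)
  show "uniform_limit (paths T) (\<lambda>N z. \<Sum>n<N. p (T + n) * z n) (total T) sequentially"
    unfolding total_def
    by (rule Weierstrass_m_test[where M = "\<lambda>n. \<bar>p (T + n)\<bar> * b"])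
       (use term_bound summable_mult2[OF summable_abs_p] in auto)
  show "\<forall>\<^sub>F N in sequentially. continuous_on (paths T) (\<lambda>z. \<Sum>n<N. p (T + n) * z n)"
    by (intro always_eventually allI continuous_intros continuous_on_coordinate)
qed simp

lemma compact_outcomes: "compact (outcomes T)"
  unfolding outcomes_def
  by (intro compact_continuous_image compact_paths continuous_on_Pair continuous_on_total
        continuous_on_coordinate)

lemma convex_outcomes: "convex (outcomes T)"
proof (rule convexI)
  fix q r :: "real \<times> real" and u v :: real
  assume qr: "q \<in> outcomes T" "r \<in> outcomes T" and uv: "0 \<le> u" "0 \<le> v" "u + v = 1"
  obtain z w where zw: "z \<in> paths T" "q = (z 0, total T z)" "w \<in> paths T" "r = (w 0, total T w)"
    using qr unfolding outcomes_def by auto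
  have "(\<lambda>n. u * z n + v * w n) \<in> paths T"
  proof (rule pathsI)
    fix n
    have "u *\<^sub>R (z n, z (Suc n)) + v *\<^sub>R (w n, w (Suc n)) \<in> \<Omega> (T + n)"
      using zw uv by (intro convexD[OF convex_Omega]) (auto simp: paths_def)
    then show "(u * z n + v * w n, u * z (Suc n) + v * w (Suc n)) \<in> \<Omega> (T + n)" by simp
  qed
  moreover have "total T (\<lambda>n. u * z n + v * w n) = u * total T z + v * total T w"
    unfolding total_def suminf_mult[OF summable_terms[OF zw(1)], symmetric]
      suminf_mult[OF summable_terms[OF zw(3)], symmetric]
    by (subst suminf_add)
       (use summable_mult[OF summable_terms[OF zw(1)], of u]
          summable_mult[OF summable_terms[OF zw(3)], of v] in \<open>simp_all add: algebra_simps\<close>)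
  ultimately show "u *\<^sub>R q + v *\<^sub>R r \<in> outcomes T"
    unfolding outcomes_def zw by (intro image_eqI) auto
qed

section \<open>Feasible sequences and the attained value\<close>

lemma feasible_imp_path:
  assumes "x \<in> feasible b \<Omega> T y"
  shows "(\<lambda>n. x (T + n)) \<in> paths T" "x T = y" "payoff p T x = total T (\<lambda>n. x (T + n))"
  using assms unfolding feasible_def payoff_def total_def by (auto intro!: pathsI)

text \<open>Before time \<open>T\<close> the truncated subtraction would yield \<open>z 0\<close>;
  \<open>restrict\<close> makes the sequence extensional on \<open>{T..}\<close>, as
  \<open>feasible\<close> requires.\<close>

lemma path_imp_feasible:
  assumes "z \<in> paths T"
  shows "restrict (\<lambda>t. z (t - T)) {T..} \<in> feasible b \<Omega> T (z 0)"
    "payoff p T (restrict (\<lambda>t. z (t - T)) {T..}) = total T z"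
proof -
  have "(z (t - T), z (Suc t - T)) \<in> \<Omega> t" if "t \<ge> T" for t
  proof -
    have "(z (t - T), z (Suc (t - T))) \<in> \<Omega> (T + (t - T))"
      using assms unfolding paths_def by blast
    then show ?thesis using that by (simp add: Suc_diff_le)
  qed
  then show "restrict (\<lambda>t. z (t - T)) {T..} \<in> feasible b \<Omega> T (z 0)"
    using paths_bounds[OF assms] unfolding feasible_def by auto
qed (simp add: payoff_def total_def)

lemma outcomes_iff_feasible: "(y, v) \<in> outcomes T \<longleftrightarrow> (\<exists>x\<in>feasible b \<Omega> T y. v = payoff p T x)"
proof
  assume "(y, v) \<in> outcomes T"
  then obtain z where "z \<in> paths T" "y = z 0" "v = total T z"
    unfolding outcomes_def by blast
  with path_imp_feasible[OF this(1)] show "\<exists>x\<in>feasible b \<Omega> T y. v = payoff p T x"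
    by metis
next
  assume "\<exists>x\<in>feasible b \<Omega> T y. v = payoff p T x"
  then obtain x where "x \<in> feasible b \<Omega> T y" "v = payoff p T x"
    by blast
  with feasible_imp_path[OF this(1)] show "(y, v) \<in> outcomes T"
    unfolding outcomes_def by (intro image_eqI[of _ _ "\<lambda>n. x (T + n)"]) auto
qed

text \<open>The section of the compact set \<open>outcomes T\<close> over \<open>y\<close> is
  non-empty and compact, so it has a largest payoff. A feasible sequence attaining it is a solution,
  so the choice in \<open>val\<close> is made from a non-empty set.\<close>

lemma val_outcome:
  assumes "y \<in> {0..b}"
  shows "(y, V T y) \<in> outcomes T" "(y, v) \<in> outcomes T \<Longrightarrow> v \<le> V T y"
proof -
  have "compact (snd ` (outcomes T \<inter> fst -` {y}))"
    by (intro compact_continuous_image compact_Int_closed compact_outcomes closed_vimage_fst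
          continuous_intros closed_singleton)
  moreover have "snd ` (outcomes T \<inter> fst -` {y}) \<noteq> {}"
    using outcomes_nonempty_section[OF assms, of T] by auto
  ultimately obtain m where m: "(y, m) \<in> outcomes T" "\<And>v. (y, v) \<in> outcomes T \<Longrightarrow> v \<le> m"
    using compact_attains_sup[of "snd ` (outcomes T \<inter> fst -` {y})"] by force
  then obtain x where x: "x \<in> feasible b \<Omega> T y" "m = payoff p T x"
    unfolding outcomes_iff_feasible by blast
  then have "x \<in> solutions b p \<Omega> T y"
    using m(2) unfolding solutions_def is_arg_max_linorder outcomes_iff_feasible by auto
  then have "V T y = m" using x val_eq_payoff by simp
  then show "(y, V T y) \<in> outcomes T" "(y, v) \<in> outcomes T \<Longrightarrow> v \<le> V T y"
    using m by auto
qed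

lemma solutions_iff:
  assumes "y \<in> {0..b}"
  shows "x \<in> solutions b p \<Omega> T y \<longleftrightarrow> x \<in> feasible b \<Omega> T y \<and> payoff p T x = V T y"
proof
  assume "x \<in> solutions b p \<Omega> T y"
  then show "x \<in> feasible b \<Omega> T y \<and> payoff p T x = V T y"
    using val_eq_payoff unfolding solutions_def is_arg_max_def by fastforce
next
  assume "x \<in> feasible b \<Omega> T y \<and> payoff p T x = V T y"
  then show "x \<in> solutions b p \<Omega> T y"
    using val_outcome(2)[OF assms] outcomes_iff_feasible
    unfolding solutions_def is_arg_max_linorder by auto
qed

section \<open>The Bellman equation and the decision rule\<close>

lemma bellman_le:
  assumes "(x, y) \<in> \<Omega> T"
  shows "p T * x + V (Suc T) y \<le> V T x"
  using Omega_bounds[OF assms] by (intro val_outcome(2) outcomes_cons[OF assms] val_outcome(1)) auto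

text \<open>Split off the first edge of an optimal outcome: the continuation is worth at most
  \<open>V (Suc T) y\<close>, and \<open>bellman_le\<close> closes the chain of
  inequalities.\<close>

lemma bellman_attained:
  assumes "x \<in> {0..b}"
  obtains y where "(x, y) \<in> \<Omega> T" "V T x = p T * x + V (Suc T) y"
proof -
  obtain y u where y: "(x, y) \<in> \<Omega> T" "(y, u) \<in> outcomes (Suc T)" "V T x = p T * x + u"
    using outcomes_uncons[OF val_outcome(1)[OF assms]] by blast
  then have "u \<le> V (Suc T) y" using Omega_bounds val_outcome(2) by blast
  then show ?thesis using that[OF y(1)] y(3) bellman_le[OF y(1)] by simp
qed

text \<open>Some successor attains the Bellman bound, so a maximizer of \<open>V (Suc T)\<close>
  attains it too, and conversely. Membership thus becomes an equation that can be passed to limits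
  and iterated; all three claims rest on it.\<close>

lemma decision_rule_iff:
  "y \<in> decision_rule b p \<Omega> T x \<longleftrightarrow> (x, y) \<in> \<Omega> T \<and> V T x = p T * x + V (Suc T) y"
proof
  assume y: "y \<in> decision_rule b p \<Omega> T x"
  then have xy: "(x, y) \<in> \<Omega> T" unfolding decision_rule_def is_arg_max_def by simp
  then obtain y' where "(x, y') \<in> \<Omega> T" "V T x = p T * x + V (Suc T) y'"
    using bellman_attained Omega_bounds by metis
  moreover from this(1) have "V (Suc T) y' \<le> V (Suc T) y"
    using y unfolding decision_rule_def is_arg_max_linorder by simp
  ultimately show "(x, y) \<in> \<Omega> T \<and> V T x = p T * x + V (Suc T) y"
    using xy bellman_le[OF xy] by simp
next
  assume "(x, y) \<in> \<Omega> T \<and> V T x = p T * x + V (Suc T) y"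
  then show "y \<in> decision_rule b p \<Omega> T x"
    using bellman_le[of x _ T] unfolding decision_rule_def is_arg_max_linorder by fastforce
qed

section \<open>Semi-continuity of the decision rule\<close>

text \<open>By compactness a subsequence of the points \<open>(ys n, V T (ys n))\<close> has a limit
  in \<open>outcomes T\<close>. It lies over \<open>y\<close>, so its payoff is at most
  \<open>V T y\<close>, and it is at least \<open>u\<close>. The convergent minorant
  \<open>us\<close> takes the place of a limit inferior.\<close>

lemma val_upper_semicontinuous:
  fixes us ys :: "nat \<Rightarrow> real"
  assumes "range ys \<subseteq> {0..b}" "y \<in> {0..b}" "ys \<longlonglongrightarrow> y" "us \<longlonglongrightarrow> u" "\<And>n. us n \<le> V T (ys n)"
  shows "u \<le> V T y"
proof -
  have "\<forall>n. (ys n, V T (ys n)) \<in> outcomes T"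
    using assms(1) by (intro allI val_outcome(1)) blast
  then obtain q r where q: "q \<in> outcomes T" "strict_mono r"
      "((\<lambda>n. (ys n, V T (ys n))) \<circ> r) \<longlonglongrightarrow> q"
    using compact_outcomes[of T] unfolding compact_def by meson
  have "(ys \<circ> r) \<longlonglongrightarrow> fst q" "(\<lambda>n. V T (ys (r n))) \<longlonglongrightarrow> snd q"
    using tendsto_fst[OF q(3)] tendsto_snd[OF q(3)] by (simp_all add: comp_def)
  moreover have "(ys \<circ> r) \<longlonglongrightarrow> y" "(us \<circ> r) \<longlonglongrightarrow> u"
    using assms(3,4) q(2) by (auto intro: LIMSEQ_subseq_LIMSEQ)
  ultimately have "fst q = y" "u \<le> snd q"
    by (auto dest: LIMSEQ_unique) (rule LIMSEQ_le, use assms(5) in auto)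
  moreover have "(fst q, snd q) \<in> outcomes T" using q(1) by simp
  ultimately show ?thesis
    using val_outcome(2)[OF assms(2), of "snd q" T] by simp
qed

text \<open>The edge survives in the limit as \<open>\<Omega> T\<close> is closed. The inequality
  opposite to \<open>bellman_le\<close> combines lower semi-continuity of \<open>V T\<close> at
  \<open>x\<close> with upper semi-continuity of \<open>V (Suc T)\<close> at
  \<open>y\<close>.\<close>

lemma usc_decision_rule:
  assumes "x \<in> {0..b}"
  shows "usc_at {0..b} (decision_rule b p \<Omega> T) x"
  unfolding usc_at_def
proof (intro ballI allI impI)
  fix y and xs ys :: "nat \<Rightarrow> real"
  assume y: "y \<in> {0..b}" and xs: "range xs \<subseteq> {0..b}" "xs \<longlonglongrightarrow> x"
    and ys: "range ys \<subseteq> {0..b}" "ys \<longlonglongrightarrow> y"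
    and h: "\<forall>n. ys n \<in> decision_rule b p \<Omega> T (xs n)"
  have "(x, y) \<in> \<Omega> T"
    using h closed_sequentially[OF closed_Omega _ tendsto_Pair[OF xs(2) ys(2)]]
    by (simp add: decision_rule_iff)
  moreover have "V T x - p T * x \<le> V (Suc T) y"
  proof -
    have "(0, V T 0) \<in> outcomes T" "(b, V T b) \<in> outcomes T"
      using b_pos by (auto intro: val_outcome(1))
    from convex_section_lower_semicontinuous[OF convex_outcomes this val_outcome(1)[OF assms]
        xs(2,1)]
    obtain ws where ws: "ws \<longlonglongrightarrow> V T x" "\<And>n. (xs n, ws n) \<in> outcomes T"
      by blast
    have "ws n \<le> V T (xs n)" for n
      using xs(1) ws(2) by (intro val_outcome(2)) blast+
    \<comment> \<open>The Bellman equation along the optimal edge from \<open>xs n\<close> to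
      \<open>ys n\<close> turns the minorant of \<open>V T\<close> into one of
      \<open>V (Suc T)\<close>.\<close>
    then have "ws n - p T * xs n \<le> V (Suc T) (ys n)" for n
      using h unfolding decision_rule_iff by (simp add: diff_le_eq add.commute)
    then show ?thesis
      by (intro val_upper_semicontinuous[OF ys(1) y ys(2), of "\<lambda>n. ws n - p T * xs n"]
            tendsto_intros ws xs)
  qed
  ultimately show "y \<in> decision_rule b p \<Omega> T x"
    using bellman_le[of x y T] unfolding decision_rule_iff by auto
qed

section \<open>Characterization of optimal sequences\<close>

text \<open>The value is the total of some path, and \<open>total_bound\<close> is uniform in the
  state. This removes the remainder when the Bellman equation is telescoped.\<close>

lemma val_tendsto_zero:
  assumes "range xs \<subseteq> {0..b}"
  shows "(\<lambda>T. V T (xs T)) \<longlonglongrightarrow> 0"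
proof (rule Lim_null_comparison)
  have "\<bar>V T (xs T)\<bar> \<le> (\<Sum>n. \<bar>p (T + n)\<bar>) * b" for T
  proof -
    have "(xs T, V T (xs T)) \<in> outcomes T"
      using assms by (intro val_outcome(1)) blast
    then obtain z where "z \<in> paths T" "V T (xs T) = total T z"
      unfolding outcomes_def by blast
    then show ?thesis using total_bound by simp
  qed
  then show "\<forall>\<^sub>F T in sequentially. norm (V T (xs T)) \<le> (\<Sum>n. \<bar>p (n + T)\<bar>) * b"
    by (simp add: add.commute)
  have "(\<lambda>T. \<Sum>n. \<bar>p (n + T)\<bar>) \<longlonglongrightarrow> 0"
    using summable_abs_p[of 0] by (intro suminf_exist_split2) simp
  then show "(\<lambda>T. (\<Sum>n. \<bar>p (n + T)\<bar>) * b) \<longlonglongrightarrow> 0"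
    by (rule tendsto_mult_left_zero)
qed

lemma solutions_iff_decision_rule:
  assumes "x \<in> {0..b}" "range xs \<subseteq> {0..b}"
  shows "xs \<in> solutions b p \<Omega> 0 x \<longleftrightarrow>
    xs 0 = x \<and> (\<forall>T. xs (Suc T) \<in> decision_rule b p \<Omega> T (xs T))"
proof
  assume "xs \<in> solutions b p \<Omega> 0 x"
  then have xs: "xs \<in> feasible b \<Omega> 0 x" "payoff p 0 xs = V 0 x"
    using solutions_iff[OF assms(1)] by auto
  then have edge: "(xs T, xs (Suc T)) \<in> \<Omega> T" and "xs 0 = x" for T
    unfolding feasible_def by auto
  have path: "(\<lambda>n. xs (T + n)) \<in> paths T" for T
    using edge by (auto intro: pathsI)
  have split: "total T (\<lambda>n. xs (T + n)) = p T * xs T + total (Suc T) (\<lambda>n. xs (Suc T + n))" for T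
    using total_split[OF path] by simp
  have le: "total T (\<lambda>n. xs (T + n)) \<le> V T (xs T)" for T
  proof (rule val_outcome(2))
    show "xs T \<in> {0..b}" using assms(2) by blast
    show "(xs T, total T (\<lambda>n. xs (T + n))) \<in> outcomes T"
      unfolding outcomes_def by (rule image_eqI[OF _ path]) simp
  qed
  \<comment> \<open>Principle of optimality: if the tail from \<open>T\<close> is optimal,
    \<open>bellman_le\<close> at its first edge makes the rest worth at least
    \<open>V (Suc T) (xs (Suc T))\<close>, and \<open>le\<close> gives the converse.\<close>
  have opt: "total T (\<lambda>n. xs (T + n)) = V T (xs T)" for T
  proof (induction T)
    case 0
    then show ?case using xs feasible_imp_path(3)[OF xs(1)] \<open>xs 0 = x\<close> by simp
  next
    case (Suc T)
    then show ?case using split[of T] le[of "Suc T"] bellman_le[OF edge[of T]] by simp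
  qed
  show "xs 0 = x \<and> (\<forall>T. xs (Suc T) \<in> decision_rule b p \<Omega> T (xs T))"
    using split edge \<open>xs 0 = x\<close> unfolding decision_rule_iff opt by blast
next
  assume xs: "xs 0 = x \<and> (\<forall>T. xs (Suc T) \<in> decision_rule b p \<Omega> T (xs T))"
  then have edge: "(xs T, xs (Suc T)) \<in> \<Omega> T"
    and bellman: "V T (xs T) = p T * xs T + V (Suc T) (xs (Suc T))" for T
    unfolding decision_rule_iff by blast+
  have feas: "xs \<in> feasible b \<Omega> 0 x"
    using xs assms(2) edge unfolding feasible_def by (auto simp: atLeast_0)
  \<comment> \<open>The Bellman equation telescopes; the remainder \<open>V N (xs N)\<close>
    vanishes as \<open>N\<close> grows, leaving the full series.\<close>
  have "V 0 x - V N (xs N) = (\<Sum>t<N. p t * xs t)" for N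
  proof (induction N)
    case 0
    then show ?case using xs by simp
  next
    case (Suc N)
    then show ?case using bellman[of N] by simp
  qed
  moreover have "(\<lambda>N. V 0 x - V N (xs N)) \<longlonglongrightarrow> V 0 x - 0"
    by (intro tendsto_intros val_tendsto_zero assms)
  ultimately have "(\<lambda>t. p t * xs t) sums V 0 x"
    unfolding sums_def by simp
  then have "payoff p 0 xs = V 0 x"
    unfolding payoff_def by (simp add: sums_iff)
  then show "xs \<in> solutions b p \<Omega> 0 x"
    using feas solutions_iff[OF assms(1)] by simp
qed

end

theorem proposition5p1:
  fixes b :: real and p :: "nat \<Rightarrow> real" and \<Omega> :: "nat \<Rightarrow> (real \<times> real) set"
  assumes "b > 0" and "ldo_problem b p \<Omega>"
  shows "(\<forall>T. \<forall>x\<in>{0..b}. usc_at {0..b} (decision_rule b p \<Omega> T) x)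
       \<and> (\<forall>T x y. (x, y) \<in> \<Omega> T \<longrightarrow> y \<notin> decision_rule b p \<Omega> T x \<longrightarrow>
            val b p \<Omega> T x > p T * x + val b p \<Omega> (Suc T) y)
       \<and> (\<forall>x\<in>{0..b}. \<forall>xs. range xs \<subseteq> {0..b} \<longrightarrow>
            (xs \<in> solutions b p \<Omega> 0 x \<longleftrightarrow>
              xs 0 = x \<and> (\<forall>T. xs (Suc T) \<in> decision_rule b p \<Omega> T (xs T))))"
proof -
  interpret ldo b p \<Omega> using assms by unfold_locales
  \<comment> \<open>Off the rule the equation of \<open>decision_rule_iff\<close> fails, so the
    inequality of \<open>bellman_le\<close> is strict.\<close>
  have "p T * x + V (Suc T) y < V T x"
    if "(x, y) \<in> \<Omega> T" "y \<notin> decision_rule b p \<Omega> T x" for T x y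
    using bellman_le[OF that(1)] that unfolding decision_rule_iff by auto
  then show ?thesis
    using usc_decision_rule solutions_iff_decision_rule by blast
qed

end
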